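(* Let $\Omega$ be an infinite set, $\{K_\theta\}_{\theta\in\Theta}$ a family of symmetric positive-definite kernels on $\Omega$, and $\{x_i\}_{i=1}^\infty$ a sequence of pairwise distinct points in $\Omega$. Let $\Delta\subset\Theta$ and $\theta_0\in\Theta$. (1) If $B$ is a set of real-valued functions on $\Omega$ such that $$\limsup_{n\to\infty}\sup_{\theta\in\Delta}\sup_{f_0\in B}\Big[\|\mu_{\theta_0,f_0}(\cdot\mid X_n)\|_{\theta_0}^2+\sum_{i=1}^n\log\frac{\mathbb V_{\theta_0}(x_i\mid X_{i-1})}{\mathbb V_\theta(x_i\mid X_{i-1})}\Big]<0,$$ then there is $N\in\mathbb{N}$ such that $\hat\theta_{\mathrm{ML}}^{f_0}(X_n)\notin\Delta$ for every $f_0\in B$ and every $n\ge N$. (2) If $B$ is a set of real-valued functions on $\Omega$ such that $$\limsup_{n\to\infty}\sup_{\theta\in\Delta}\sup_{f_0\in B}\sum_{i=1}^n\Big[\frac{(f_0(x_i)-\mu_{\theta_0,f_0}(x_i\mid X_n^i))^2}{\mathbb V_{\theta_0}(x_i\mid X_n^i)}+\log\frac{\mathbb V_{\theta_0}(x_i\mid X_n^i)}{\mathbb V_\theta(x_i\mid X_n^i)}\Big]<0,$$ then there is $N\in\mathbb{N}$ such that $\hat\theta_{\mathrm{CV}}^{f_0}(X_n)\notin\Delta$ for every $f_0\in B$ and every $n\ge N$.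
   Context: A kernel $K_\theta:\Omega\times\Omega\to\mathbb{R}$ is symmetric and positive-definite in the strict sense: $\sum_{i,j=1}^na_ia_jK_\theta(x_i,x_j)>0$ for all $n\in\mathbb{N}$, pairwise distinct $x_1,\dots,x_n\in\Omega$ and non-zero $(a_1,\dots,a_n)\in\mathbb{R}^n$. $H(K_\theta)$ is its reproducing kernel Hilbert space with norm $\|\cdot\|_\theta$. Notation: $X_n=\{x_i\}_{i=1}^n$, $X_0=\emptyset$, $X_n^i=X_n\setminus\{x_i\}$. For a finite set $X$ of distinct points, $f_0(X)$ is the column vector of values of $f_0$ at the points of $X$, $K_\theta(X)$ is the matrix with entries $K_\theta(x_i,x_j)$, and $K_\theta(x,X)$ the column vector with entries $K_\theta(x,x_i)$. The conditional mean and variance are $$\mu_{\theta,f_0}(x\mid X)=K_\theta(x,X)^{\mathsf T}K_\theta(X)^{-1}f_0(X),\qquad \mathbb V_\theta(x\mid X)=K_\theta(x,x)-K_\theta(x,X)^{\mathsf T}K_\theta(X)^{-1}K_\theta(x,X),$$ with $\mu_{\theta,f_0}(x\mid\emptyset)=0$ and $\mathbb V_\theta(x\mid\emptyset)=K_\theta(x,x)$. Estimators: $\hat\theta_{\mathrm{ML}}^{f_0}(X_n)$ is any minimiser over $\theta\in\Theta$ of $$\ell_{\mathrm{ML}}^{f_0}(\theta\mid X_n)=f_0(X_n)^{\mathsf T}K_\theta(X_n)^{-1}f_0(X_n)+\log\det K_\theta(X_n),$$ and $\hat\theta_{\mathrm{CV}}^{f_0}(X_n)$ is any minimiser over $\theta\in\Theta$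 of $$\ell_{\mathrm{CV}}^{f_0}(\theta\mid X_n)=\sum_{i=1}^n\Big[\frac{(f_0(x_i)-\mu_{\theta,f_0}(x_i\mid X_n^i))^2}{\mathbb V_\theta(x_i\mid X_n^i)}+\log\mathbb V_\theta(x_i\mid X_n^i)\Big].$$ Minimisers are assumed to exist; results hold for an arbitrary choice of minimisers. *)

theory Defs
  imports
    "HOL-Library.FuncSet"
    "HOL-Library.Extended_Real"
    "HOL-Library.Liminf_Limsup"
    "Jordan_Normal_Form.Determinant"
    "Jordan_Normal_Form.Gauss_Jordan_Elimination"
begin

definition sympd_kernel :: "'a set \<Rightarrow> ('a \<Rightarrow> 'a \<Rightarrow> real) \<Rightarrow> bool" where
  "sympd_kernel \<Omega> K \<longleftrightarrow>
     (\<forall>x\<in>\<Omega>. \<forall>y\<in>\<Omega>. K x y = K y x) \<and>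
     (\<forall>(n::nat) (x::nat \<Rightarrow> 'a) (a::nat \<Rightarrow> real).
        x ` {1..n} \<subseteq> \<Omega> \<and> inj_on x {1..n} \<and> (\<exists>i\<in>{1..n}. a i \<noteq> 0) \<longrightarrow>
        (\<Sum>i=1..n. \<Sum>j=1..n. a i * a j * K (x i) (x j)) > 0)"

text \<open>Real-valued functions on \<open>\<Omega>\<close> are represented by the elements of \<open>extensional \<Omega>\<close>,
  so that equality in HOL is equality on \<open>\<Omega>\<close>.\<close>

definition hilbert_function_space ::
    "'a set \<Rightarrow> ('a \<Rightarrow> real) set \<Rightarrow> (('a \<Rightarrow> real) \<Rightarrow> ('a \<Rightarrow> real) \<Rightarrow> real) \<Rightarrow> bool" where
  "hilbert_function_space \<Omega> H ip \<longleftrightarrow>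
     H \<subseteq> extensional \<Omega> \<and>
     (\<lambda>x\<in>\<Omega>. 0) \<in> H \<and>
     (\<forall>f\<in>H. \<forall>g\<in>H. (\<lambda>x\<in>\<Omega>. f x + g x) \<in> H) \<and>
     (\<forall>c. \<forall>f\<in>H. (\<lambda>x\<in>\<Omega>. c * f x) \<in> H) \<and>
     (\<forall>f\<in>H. \<forall>g\<in>H. ip f g = ip g f) \<and>
     (\<forall>f\<in>H. \<forall>g\<in>H. \<forall>h\<in>H. ip (\<lambda>x\<in>\<Omega>. f x + g x) h = ip f h + ip g h) \<and>
     (\<forall>c. \<forall>f\<in>H. \<forall>g\<in>H. ip (\<lambda>x\<in>\<Omega>. c * f x) g = c * ip f g) \<and>
     (\<forall>f\<in>H. f \<noteq> (\<lambda>x\<in>\<Omega>. 0) \<longrightarrow> ip f f > 0) \<and>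
     (let dst = (\<lambda>f g. sqrt (ip (\<lambda>x\<in>\<Omega>. f x - g x) (\<lambda>x\<in>\<Omega>. f x - g x))) in
      \<forall>s. (\<forall>n::nat. s n \<in> H) \<and> (\<forall>e>0. \<exists>M. \<forall>m\<ge>M. \<forall>n\<ge>M. dst (s m) (s n) < e) \<longrightarrow>
          (\<exists>f\<in>H. (\<lambda>n. dst (s n) f) \<longlonglongrightarrow> 0))"

definition is_rkhs ::
    "'a set \<Rightarrow> ('a \<Rightarrow> 'a \<Rightarrow> real) \<Rightarrow> ('a \<Rightarrow> real) set \<Rightarrow>
     (('a \<Rightarrow> real) \<Rightarrow> ('a \<Rightarrow> real) \<Rightarrow> real) \<Rightarrow> bool" where
  "is_rkhs \<Omega> K H ip \<longleftrightarrow>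
     hilbert_function_space \<Omega> H ip \<and>
     (\<forall>x\<in>\<Omega>. (\<lambda>y\<in>\<Omega>. K y x) \<in> H) \<and>
     (\<forall>x\<in>\<Omega>. \<forall>f\<in>H. ip f (\<lambda>y\<in>\<Omega>. K y x) = f x)"

text \<open>By the Moore--Aronszajn theorem a positive-definite kernel has exactly one reproducing kernel
  Hilbert space, so the description below denotes the norm of \<open>f\<close> (restricted to \<open>\<Omega>\<close>) in that
  space; it is unspecified if \<open>f\<close> does not belong to it.\<close>

definition rkhs_norm :: "'a set \<Rightarrow> ('a \<Rightarrow> 'a \<Rightarrow> real) \<Rightarrow> ('a \<Rightarrow> real) \<Rightarrow> real" where
  "rkhs_norm \<Omega> K f =
     (THE r. \<exists>H ip. is_rkhs \<Omega> K H ip \<and> restrict f \<Omega> \<in> H \<and>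
                    r = sqrt (ip (restrict f \<Omega>) (restrict f \<Omega>)))"

text \<open>A finite set of points is represented by a distinct list enumerating it; the quantities below
  that are not vectors or matrices do not depend on the enumeration.\<close>

definition fun_vec :: "('a \<Rightarrow> real) \<Rightarrow> 'a list \<Rightarrow> real vec" where
  "fun_vec f X = vec (length X) (\<lambda>i. f (X ! i))"

definition kernel_mat :: "('a \<Rightarrow> 'a \<Rightarrow> real) \<Rightarrow> 'a list \<Rightarrow> real mat" where
  "kernel_mat K X = mat (length X) (length X) (\<lambda>(i, j). K (X ! i) (X ! j))"

definition kernel_mat_inv :: "('a \<Rightarrow> 'a \<Rightarrow> real) \<Rightarrow> 'a list \<Rightarrow> real mat" where
  "kernel_mat_inv K X = the (mat_inverse (kernel_mat K X))"

definition cond_mean ::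
    "('a \<Rightarrow> 'a \<Rightarrow> real) \<Rightarrow> ('a \<Rightarrow> real) \<Rightarrow> 'a list \<Rightarrow> 'a \<Rightarrow> real" where
  "cond_mean K f X x =
     (if X = [] then 0
      else fun_vec (K x) X \<bullet> (kernel_mat_inv K X *\<^sub>v fun_vec f X))"

definition cond_var :: "('a \<Rightarrow> 'a \<Rightarrow> real) \<Rightarrow> 'a list \<Rightarrow> 'a \<Rightarrow> real" where
  "cond_var K X x =
     (if X = [] then K x x
      else K x x - fun_vec (K x) X \<bullet> (kernel_mat_inv K X *\<^sub>v fun_vec (K x) X))"

definition first_pts :: "(nat \<Rightarrow> 'a) \<Rightarrow> nat \<Rightarrow> 'a list" where
  "first_pts x n = map x [1..<Suc n]"

definition ml_loss :: "('a \<Rightarrow> 'a \<Rightarrow> real) \<Rightarrow> ('a \<Rightarrow> real) \<Rightarrow> 'a list \<Rightarrow> real" where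
  "ml_loss K f X =
     fun_vec f X \<bullet> (kernel_mat_inv K X *\<^sub>v fun_vec f X) + ln (det (kernel_mat K X))"

text \<open>\<open>removeAll p X\<close> enumerates the set \<open>X - {p}\<close>, i.e. it is the leave-one-out point set.\<close>

definition cv_loss :: "('a \<Rightarrow> 'a \<Rightarrow> real) \<Rightarrow> ('a \<Rightarrow> real) \<Rightarrow> 'a list \<Rightarrow> real" where
  "cv_loss K f X =
     (\<Sum>p\<in>set X. (f p - cond_mean K f (removeAll p X) p)\<^sup>2 / cond_var K (removeAll p X) p
                  + ln (cond_var K (removeAll p X) p))"

end

theory Submission
  imports Defs
begin

text \<open>
  By the chain rule for determinants, \<open>det K(X\<^sub>n)\<close> is the product of the successive conditional
  variances, and the squared norm of the conditional mean is the quadratic form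
  \<open>f(X)\<^sup>T K(X)\<^sup>-\<^sup>1 f(X)\<close>. Hence in either case the bracketed expression bounds the loss at \<open>\<theta>0\<close>
  minus the loss at \<open>\<theta>\<close>: the only term dropped is the nonnegative data-fit term of \<open>\<theta>\<close>. Once it is
  negative uniformly over \<open>\<Delta>\<close>, no element of \<open>\<Delta>\<close> can be a minimiser.

  For the norm to be meaningful the reproducing kernel Hilbert space must exist. It is realised as
  the functions for which \<open>f(X)\<^sup>T K(X)\<^sup>-\<^sup>1 f(X)\<close> is bounded over finite sets \<open>X\<close>. This form
  increases with \<open>X\<close>, so by polarization \<open>f(X)\<^sup>T K(X)\<^sup>-\<^sup>1 g(X)\<close> converges along the finite
  subsets of the domain, and the limit is the inner product; completeness is obtained from pointwise
  limits.
\<close>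

text \<open>Coefficients are indexed by the points themselves, so that statements about
  \<open>K(X)\<close> become statements about finite sets and need no enumeration.\<close>

definition kernel_comb :: "('a \<Rightarrow> 'a \<Rightarrow> real) \<Rightarrow> ('a \<Rightarrow> real) \<Rightarrow> 'a set \<Rightarrow> 'a \<Rightarrow> real" where
  "kernel_comb K c X z = (\<Sum>y\<in>X. c y * K z y)"

section \<open>Vectors and matrices over an enumeration\<close>

lemma sum_set_conv_nth:
  assumes "distinct L"
  shows "(\<Sum>y\<in>set L. g y) = (\<Sum>i<length L. g (L ! i))"
  using assms by (simp add: sum.distinct_set_conv_list sum_list_sum_nth atLeast0LessThan)

lemma fun_vec_carrier [simp]: "fun_vec f L \<in> carrier_vec (length L)" "dim_vec (fun_vec f L) = length L"
  by (auto simp: fun_vec_def)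

lemma kernel_mat_carrier [simp]: "kernel_mat K L \<in> carrier_mat (length L) (length L)"
  by (auto simp: kernel_mat_def)

lemma fun_vec_eq_iff: "fun_vec f L = fun_vec g L \<longleftrightarrow> (\<forall>z\<in>set L. f z = g z)"
  by (simp add: fun_vec_def vec_eq_iff all_set_conv_all_nth)

lemma fun_vec_scalar_prod:
  assumes "distinct L"
  shows "fun_vec f L \<bullet> fun_vec g L = (\<Sum>y\<in>set L. f y * g y)"
  using assms by (simp add: sum_set_conv_nth scalar_prod_def fun_vec_def atLeast0LessThan)

lemma kernel_mat_mult_fun_vec:
  assumes "distinct L"
  shows "kernel_mat K L *\<^sub>v fun_vec c L = fun_vec (kernel_comb K c (set L)) L"
  using assms
  by (intro eq_vecI)
     (auto simp: kernel_comb_def sum_set_conv_nth scalar_prod_def fun_vec_def kernel_mat_def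
        atLeast0LessThan mult.commute)

text \<open>Distinctness makes the position of a point in \<open>L\<close> unique, so the entries of
  a vector can be read as coefficients attached to points.\<close>

lemma vec_conv_fun_vec:
  assumes "distinct L" "v \<in> carrier_vec (length L)"
  obtains c where "v = fun_vec c L"
proof
  show "v = fun_vec (\<lambda>y. v $ (THE i. i < length L \<and> L ! i = y)) L"
  proof (rule eq_vecI)
    fix i assume "i < dim_vec (fun_vec (\<lambda>y. v $ (THE i. i < length L \<and> L ! i = y)) L)"
    then have i: "i < length L" by simp
    then have "(THE j. j < length L \<and> L ! j = L ! i) = i"
      using assms(1) by (auto simp: nth_eq_iff_index_eq)
    then show "v $ i = fun_vec (\<lambda>y. v $ (THE i. i < length L \<and> L ! i = y)) L $ i"
      using i by (simp add: fun_vec_def)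
  qed (use assms in auto)
qed

section \<open>Interpolation by kernel combinations\<close>

locale pd_kernel =
  fixes \<Omega> :: "'a set" and K :: "'a \<Rightarrow> 'a \<Rightarrow> real"
  assumes sympd: "sympd_kernel \<Omega> K"
begin

lemma kernel_sym: "x \<in> \<Omega> \<Longrightarrow> y \<in> \<Omega> \<Longrightarrow> K x y = K y x"
  using sympd by (auto simp: sympd_kernel_def)

text \<open>Strict positive-definiteness, moved from families indexed by \<open>{1..n}\<close> to
  finite sets of points; the sum is \<open>c\<^sup>T K(X) c\<close>.\<close>

lemma energy_pos:
  assumes "finite X" "X \<subseteq> \<Omega>" "x \<in> X" "c x \<noteq> 0"
  shows "0 < (\<Sum>z\<in>X. c z * kernel_comb K c X z)"
proof -
  obtain L where L: "distinct L" "set L = X"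
    using assms(1) finite_distinct_list by blast
  \<comment> \<open>Families in \<open>sympd_kernel\<close> start at index 1, lists at 0.\<close>
  define p where "p i = L ! (i - 1)" for i
  have bij: "bij_betw p {1..length L} X"
  proof -
    have "bij_betw (\<lambda>i. i - 1) {1..length L} {..<length L}"
      by (rule bij_betwI[where g = Suc]) auto
    from bij_betw_trans[OF this bij_betw_nth[OF L(1) refl L(2)[symmetric]]]
    show ?thesis by (simp add: p_def[abs_def] comp_def)
  qed
  then obtain i where i: "i \<in> {1..length L}" "c (p i) \<noteq> 0"
    using assms(3,4) by (auto simp: bij_betw_def)
  have "p ` {1..length L} \<subseteq> \<Omega> \<and> inj_on p {1..length L} \<and> (\<exists>i\<in>{1..length L}. c (p i) \<noteq> 0)"
    using bij assms(2) i by (auto simp: bij_betw_def)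
  then have "0 < (\<Sum>i=1..length L. \<Sum>j=1..length L. c (p i) * c (p j) * K (p i) (p j))"
    using sympd unfolding sympd_kernel_def by (elim conjE allE[of _ "length L"] allE[of _ p]
        allE[of _ "\<lambda>i. c (p i)"]) blast
  also have "\<dots> = (\<Sum>i=1..length L. \<Sum>y\<in>X. c (p i) * c y * K (p i) y)"
    by (intro sum.cong refl) (rule sum.reindex_bij_betw[OF bij])
  also have "\<dots> = (\<Sum>z\<in>X. \<Sum>y\<in>X. c z * c y * K z y)"
    by (rule sum.reindex_bij_betw[OF bij])
  finally show ?thesis
    by (simp add: kernel_comb_def sum_distrib_left mult.assoc)
qed

lemma energy_nonneg:
  assumes "finite X" "X \<subseteq> \<Omega>"
  shows "0 \<le> (\<Sum>z\<in>X. c z * kernel_comb K c X z)"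
proof (cases "\<exists>x\<in>X. c x \<noteq> 0")
  case True
  then show ?thesis using energy_pos[OF assms] by (auto intro: less_imp_le)
qed simp

text \<open>By symmetry of \<open>K\<close>, both sides are the double sum of
  \<open>c y * d z * K y z\<close>, the inner product of the two combinations.\<close>

lemma kernel_comb_swap:
  assumes "X \<subseteq> \<Omega>" "Y \<subseteq> \<Omega>"
  shows "(\<Sum>y\<in>X. kernel_comb K d Y y * c y) = (\<Sum>z\<in>Y. d z * kernel_comb K c X z)"
proof -
  have "(\<Sum>y\<in>X. kernel_comb K d Y y * c y) = (\<Sum>y\<in>X. \<Sum>z\<in>Y. d z * K y z * c y)"
    by (simp add: kernel_comb_def sum_distrib_right)
  also have "\<dots> = (\<Sum>z\<in>Y. \<Sum>y\<in>X. d z * K y z * c y)"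
    by (rule sum.swap)
  also have "\<dots> = (\<Sum>z\<in>Y. \<Sum>y\<in>X. d z * (c y * K z y))"
    using assms by (intro sum.cong refl) (auto simp: kernel_sym subset_iff)
  finally show ?thesis by (simp add: kernel_comb_def sum_distrib_left)
qed

text \<open>A nonzero null vector, read as coefficients, would have zero energy, against strict
  positive-definiteness.\<close>

lemma det_kernel_mat_nonzero:
  assumes "distinct L" "set L \<subseteq> \<Omega>"
  shows "det (kernel_mat K L) \<noteq> 0"
proof
  assume "det (kernel_mat K L) = 0"
  then obtain v where v: "v \<in> carrier_vec (length L)" "v \<noteq> 0\<^sub>v (length L)"
    "kernel_mat K L *\<^sub>v v = 0\<^sub>v (length L)"
    using det_0_iff_vec_prod_zero[OF kernel_mat_carrier] by blast
  have zero: "0\<^sub>v (length L) = fun_vec (\<lambda>_. 0) L"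
    by (auto simp: fun_vec_def)
  obtain c where c: "v = fun_vec c L"
    using vec_conv_fun_vec[OF assms(1) v(1)] .
  obtain x where x: "x \<in> set L" "c x \<noteq> 0"
    using v(2) unfolding zero c fun_vec_eq_iff by auto
  have "\<forall>z\<in>set L. kernel_comb K c (set L) z = 0"
    using v(3) unfolding zero c kernel_mat_mult_fun_vec[OF assms(1)] fun_vec_eq_iff .
  then have "(\<Sum>z\<in>set L. c z * kernel_comb K c (set L) z) = 0" by simp
  with energy_pos[where X = "set L"] x assms(2) show False by fastforce
qed

lemma kernel_mat_inv:
  assumes "distinct L" "set L \<subseteq> \<Omega>"
  shows "kernel_mat_inv K L \<in> carrier_mat (length L) (length L)"
    and "kernel_mat K L * kernel_mat_inv K L = 1\<^sub>m (length L)"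
proof -
  have "kernel_mat K L \<in> Units (ring_mat TYPE(real) (length L) ())"
    by (rule det_non_zero_imp_unit[OF kernel_mat_carrier det_kernel_mat_nonzero[OF assms]])
  then have "mat_inverse (kernel_mat K L) \<noteq> None"
    using mat_inverse(1)[OF kernel_mat_carrier] by metis
  then have "mat_inverse (kernel_mat K L) = Some (kernel_mat_inv K L)"
    by (auto simp: kernel_mat_inv_def)
  from mat_inverse(2)[OF kernel_mat_carrier this]
  show "kernel_mat_inv K L \<in> carrier_mat (length L) (length L)"
    and "kernel_mat K L * kernel_mat_inv K L = 1\<^sub>m (length L)"
    by simp_all
qed

text \<open>Links the inverse matrix to coefficients: applying \<open>K(L)\<close> to
  \<open>K(L)\<^sup>-\<^sup>1 f(L)\<close> evaluates the combination with these coefficients on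
  \<open>L\<close> and returns \<open>f(L)\<close>.\<close>

lemma kernel_mat_inv_interpolates:
  assumes "distinct L" "set L \<subseteq> \<Omega>"
  obtains c where "kernel_mat_inv K L *\<^sub>v fun_vec f L = fun_vec c L"
    and "\<And>z. z \<in> set L \<Longrightarrow> kernel_comb K c (set L) z = f z"
proof -
  note M = kernel_mat_inv[OF assms]
  have "kernel_mat_inv K L *\<^sub>v fun_vec f L \<in> carrier_vec (length L)"
    using M(1) by auto
  then obtain c where c: "kernel_mat_inv K L *\<^sub>v fun_vec f L = fun_vec c L"
    using vec_conv_fun_vec[OF assms(1)] by metis
  have "fun_vec (kernel_comb K c (set L)) L = kernel_mat K L *\<^sub>v (kernel_mat_inv K L *\<^sub>v fun_vec f L)"
    by (simp add: c kernel_mat_mult_fun_vec[OF assms(1)])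
  also have "\<dots> = kernel_mat K L * kernel_mat_inv K L *\<^sub>v fun_vec f L"
    by (rule assoc_mult_mat_vec[symmetric, OF kernel_mat_carrier M(1) fun_vec_carrier(1)])
  also have "\<dots> = fun_vec f L"
    by (simp add: M(2))
  finally show thesis using that c unfolding fun_vec_eq_iff by blast
qed

section \<open>The form \<open>f(X)\<^sup>T K(X)\<^sup>-\<^sup>1 g(X)\<close> on finite sets\<close>

definition interpolant :: "'a set \<Rightarrow> ('a \<Rightarrow> real) \<Rightarrow> 'a \<Rightarrow> real" where
  "interpolant X f = (SOME c. \<forall>z\<in>X. kernel_comb K c X z = f z)"

text \<open>Since \<open>interpolant X g\<close> stands for
  \<open>K(X)\<^sup>-\<^sup>1 g(X)\<close>, the case \<open>f = g\<close> is the data-fit term of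
  the likelihood, freed of the enumeration of \<open>X\<close>.\<close>

definition gram_form :: "'a set \<Rightarrow> ('a \<Rightarrow> real) \<Rightarrow> ('a \<Rightarrow> real) \<Rightarrow> real" where
  "gram_form X f g = (\<Sum>y\<in>X. f y * interpolant X g y)"

lemma kernel_comb_interpolant:
  assumes "finite X" "X \<subseteq> \<Omega>" "z \<in> X"
  shows "kernel_comb K (interpolant X f) X z = f z"
proof -
  obtain L where L: "distinct L" "set L = X"
    using assms(1) finite_distinct_list by blast
  have "\<exists>c. \<forall>z\<in>X. kernel_comb K c X z = f z"
    using kernel_mat_inv_interpolates[of L f] L assms(2) by metis
  from someI_ex[OF this] show ?thesis
    using assms(3) by (simp add: interpolant_def)
qed

text \<open>Swapping moves the coefficients over to \<open>f\<close>. The sum then depends on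
  \<open>c\<close> only through the values of its combination on \<open>X\<close>, so the choice
  made in \<open>interpolant\<close> does not matter.\<close>

lemma gram_form_eq:
  assumes "finite X" "X \<subseteq> \<Omega>" "\<And>z. z \<in> X \<Longrightarrow> kernel_comb K c X z = g z"
  shows "gram_form X f g = (\<Sum>y\<in>X. f y * c y)"
proof -
  have *: "(\<Sum>y\<in>X. f y * d y) = (\<Sum>z\<in>X. interpolant X f z * kernel_comb K d X z)" for d
    using kernel_comb_swap[OF assms(2,2), of "interpolant X f" d]
    by (simp add: kernel_comb_interpolant[OF assms(1,2)])
  show ?thesis
    by (simp add: gram_form_def * kernel_comb_interpolant[OF assms(1,2)] assms(3))
qed

lemma gram_form_list:
  assumes "distinct L" "set L \<subseteq> \<Omega>"
  shows "fun_vec f L \<bullet> (kernel_mat_inv K L *\<^sub>v fun_vec g L) = gram_form (set L) f g"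
proof -
  obtain c where "kernel_mat_inv K L *\<^sub>v fun_vec g L = fun_vec c L"
    "\<And>z. z \<in> set L \<Longrightarrow> kernel_comb K c (set L) z = g z"
    using kernel_mat_inv_interpolates[OF assms] by metis
  then show ?thesis
    using assms by (simp add: fun_vec_scalar_prod gram_form_eq[where c = c])
qed

lemma gram_form_sym:
  assumes "finite X" "X \<subseteq> \<Omega>"
  shows "gram_form X f g = gram_form X g f"
  using kernel_comb_swap[OF assms(2,2), of "interpolant X f" "interpolant X g"]
  by (simp add: gram_form_def kernel_comb_interpolant[OF assms] mult.commute)

lemma gram_form_add_left: "gram_form X (\<lambda>x. f x + g x) h = gram_form X f h + gram_form X g h"
  by (simp add: gram_form_def sum.distrib algebra_simps)

lemma gram_form_scale_left: "gram_form X (\<lambda>x. c * f x) h = c * gram_form X f h"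
  by (simp add: gram_form_def sum_distrib_left mult.assoc)

text \<open>\<open>interpolant\<close> chooses by a condition that sees its function on
  \<open>X\<close> only, so functions agreeing on \<open>X\<close> get the very same
  coefficients.\<close>

lemma gram_form_cong:
  assumes "\<And>x. x \<in> X \<Longrightarrow> f x = f' x" "\<And>x. x \<in> X \<Longrightarrow> g x = g' x"
  shows "gram_form X f g = gram_form X f' g'"
  using assms by (simp add: gram_form_def interpolant_def)

lemma gram_form_nonneg:
  assumes "finite X" "X \<subseteq> \<Omega>"
  shows "0 \<le> gram_form X f f"
  using energy_nonneg[OF assms, of "interpolant X f"]
  by (simp add: gram_form_def kernel_comb_interpolant[OF assms] mult.commute)

lemma gram_form_singleton:
  assumes "x \<in> \<Omega>"
  shows "0 < K x x" "gram_form {x} f f = (f x)\<^sup>2 / K x x"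
proof -
  show pos: "0 < K x x"
    using energy_pos[of "{x}" x "\<lambda>_. 1"] assms by (simp add: kernel_comb_def)
  show "gram_form {x} f f = (f x)\<^sup>2 / K x x"
    using pos assms
    by (subst gram_form_eq[where c = "\<lambda>_. f x / K x x"])
       (auto simp: kernel_comb_def power2_eq_square)
qed

text \<open>The difference of the two sides is the squared norm of the difference of the two
  interpolants.\<close>

lemma gram_form_mono:
  assumes "finite Y" "X \<subseteq> Y" "Y \<subseteq> \<Omega>"
  shows "gram_form X f f \<le> gram_form Y f f"
proof -
  have X: "finite X" "X \<subseteq> \<Omega>" using assms finite_subset by auto
  define c d where "c = interpolant X f" and "d = interpolant Y f"
  \<comment> \<open>Extension by zero puts both combinations on \<open>Y\<close>, so that their
    difference has an energy there.\<close>
  define c' where "c' y = (if y \<in> X then c y else 0)" for y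
  have on_X: "(\<Sum>y\<in>Y. c' y * g y) = (\<Sum>y\<in>X. c y * g y)" for g
  proof -
    have "(\<Sum>y\<in>Y. c' y * g y) = (\<Sum>y\<in>X. c' y * g y)"
      using assms by (intro sum.mono_neutral_right) (auto simp: c'_def)
    then show ?thesis by (simp add: c'_def)
  qed
  have comb: "kernel_comb K c' Y z = kernel_comb K c X z" for z
    using on_X by (simp add: kernel_comb_def)
  have cX: "kernel_comb K c X z = f z" if "z \<in> X" for z
    using that kernel_comb_interpolant[OF X] by (simp add: c_def)
  have dY: "kernel_comb K d Y z = f z" if "z \<in> Y" for z
    using that kernel_comb_interpolant[OF assms(1,3)] by (simp add: d_def)
  have diff: "kernel_comb K (\<lambda>y. d y - c' y) Y z = f z - kernel_comb K c X z" if "z \<in> Y" for z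
    using dY[OF that] comb[of z]
    by (simp add: kernel_comb_def sum_subtractf left_diff_distrib)
  have "0 \<le> (\<Sum>z\<in>Y. (d z - c' z) * kernel_comb K (\<lambda>y. d y - c' y) Y z)"
    by (rule energy_nonneg[OF assms(1,3)])
  also have "\<dots> = (\<Sum>z\<in>Y. (d z - c' z) * (f z - kernel_comb K c X z))"
    using diff by simp
  also have "\<dots> = (\<Sum>z\<in>Y. d z * f z) - (\<Sum>z\<in>Y. d z * kernel_comb K c X z)
      - (\<Sum>z\<in>X. c z * (f z - kernel_comb K c X z))"
    by (simp add: on_X left_diff_distrib right_diff_distrib sum_subtractf)
  \<comment> \<open>The residual vanishes on \<open>X\<close>, which is its orthogonality to the
    kernel sections at the points of \<open>X\<close>.\<close>
  also have "(\<Sum>z\<in>X. c z * (f z - kernel_comb K c X z)) = 0"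
    using cX by simp
  also have "(\<Sum>z\<in>Y. d z * f z) = gram_form Y f f"
    by (simp add: gram_form_def d_def mult.commute)
  also have "(\<Sum>z\<in>Y. d z * kernel_comb K c X z) = gram_form X f f"
  proof -
    have "(\<Sum>z\<in>Y. d z * kernel_comb K c X z) = (\<Sum>y\<in>X. kernel_comb K d Y y * c y)"
      by (rule kernel_comb_swap[OF X(2) assms(3), symmetric])
    also have "\<dots> = (\<Sum>y\<in>X. f y * c y)"
      using dY assms(2) by (intro sum.cong) auto
    finally show ?thesis by (simp add: gram_form_def c_def)
  qed
  finally show ?thesis by simp
qed

text \<open>The coefficients are expanded in the interpolants of one-point indicators, the columns
  of \<open>K(X)\<^sup>-\<^sup>1\<close>. The form becomes a fixed finite sum in the values of
  \<open>f\<close> and \<open>g\<close>, hence continuous under pointwise convergence.\<close>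

lemma gram_form_explicit:
  assumes "finite X" "X \<subseteq> \<Omega>"
  shows "gram_form X f g = (\<Sum>y\<in>X. f y * (\<Sum>u\<in>X. g u * interpolant X (\<lambda>z. if z = u then 1 else 0) y))"
proof (rule gram_form_eq[OF assms])
  fix z assume z: "z \<in> X"
  let ?e = "\<lambda>u z. if z = u then 1 else 0"
  have "kernel_comb K (\<lambda>y. \<Sum>u\<in>X. g u * interpolant X (?e u) y) X z
      = (\<Sum>y\<in>X. \<Sum>u\<in>X. g u * (interpolant X (?e u) y * K z y))"
    by (simp add: kernel_comb_def sum_distrib_right mult.assoc)
  also have "\<dots> = (\<Sum>u\<in>X. \<Sum>y\<in>X. g u * (interpolant X (?e u) y * K z y))"
    by (rule sum.swap)
  also have "\<dots> = (\<Sum>u\<in>X. g u * kernel_comb K (interpolant X (?e u)) X z)"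
    by (simp add: kernel_comb_def sum_distrib_left)
  also have "\<dots> = (\<Sum>u\<in>X. g u * ?e u z)"
    using kernel_comb_interpolant[OF assms z] by simp
  also have "\<dots> = (\<Sum>u\<in>X. if z = u then g u else 0)"
    by (intro sum.cong) auto
  also have "\<dots> = g z"
    using z assms(1) by simp
  finally show "kernel_comb K (\<lambda>y. \<Sum>u\<in>X. g u * interpolant X (?e u) y) X z = g z" .
qed

lemma tendsto_gram_form:
  assumes "finite X" "X \<subseteq> \<Omega>" "\<And>x. x \<in> X \<Longrightarrow> ((\<lambda>n. f n x) \<longlongrightarrow> f' x) F"
  shows "((\<lambda>n. gram_form X (f n) (f n)) \<longlongrightarrow> gram_form X f' f') F"
  unfolding gram_form_explicit[OF assms(1,2)]
  by (intro tendsto_sum tendsto_mult assms(3) tendsto_const)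


lemma gram_form_add_right:
  assumes "finite X" "X \<subseteq> \<Omega>"
  shows "gram_form X h (\<lambda>x. f x + g x) = gram_form X h f + gram_form X h g"
  using gram_form_add_left by (simp add: gram_form_sym[OF assms, of h])

lemma gram_form_scale_right:
  assumes "finite X" "X \<subseteq> \<Omega>"
  shows "gram_form X h (\<lambda>x. c * f x) = c * gram_form X h f"
  using gram_form_scale_left by (simp add: gram_form_sym[OF assms, of h])

lemma gram_form_scale:
  assumes "finite X" "X \<subseteq> \<Omega>"
  shows "gram_form X (\<lambda>x. c * f x) (\<lambda>x. c * f x) = c\<^sup>2 * gram_form X f f"
  using gram_form_scale_left gram_form_scale_right[OF assms] by (simp add: power2_eq_square)

lemma gram_form_add_square:
  assumes "finite X" "X \<subseteq> \<Omega>"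
  shows "gram_form X (\<lambda>x. f x + g x) (\<lambda>x. f x + g x)
    = gram_form X f f + 2 * gram_form X f g + gram_form X g g"
  by (simp add: gram_form_add_left gram_form_add_right[OF assms] gram_form_sym[OF assms, of g f])

lemma gram_form_diff_square:
  assumes "finite X" "X \<subseteq> \<Omega>"
  shows "gram_form X (\<lambda>x. f x - g x) (\<lambda>x. f x - g x)
    = gram_form X f f - 2 * gram_form X f g + gram_form X g g"
  using gram_form_add_square[OF assms, of f "\<lambda>x. - 1 * g x"]
  by (simp add: gram_form_scale[OF assms, of "- 1", simplified]
      gram_form_scale_right[OF assms, of _ "- 1", simplified])

section \<open>Existence of the reproducing kernel Hilbert space\<close>

definition bounded_gram :: "('a \<Rightarrow> real) \<Rightarrow> bool" where
  "bounded_gram f \<longleftrightarrow> (\<exists>C. \<forall>X. finite X \<and> X \<subseteq> \<Omega> \<longrightarrow> gram_form X f f \<le> C)"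

definition rkhs :: "('a \<Rightarrow> real) set" where
  "rkhs = {f \<in> extensional \<Omega>. bounded_gram f}"

text \<open>A limit along finite sets rather than a supremum, so that symmetry and bilinearity pass
  to it directly. \<open>Lim\<close> is unspecified where no limit exists; for two functions with
  bounded form there is one, by polarization.\<close>

definition rkhs_ip :: "('a \<Rightarrow> real) \<Rightarrow> ('a \<Rightarrow> real) \<Rightarrow> real" where
  "rkhs_ip f g = Lim (finite_subsets_at_top \<Omega>) (\<lambda>X. gram_form X f g)"

lemma bounded_gramI:
  "(\<And>X. finite X \<Longrightarrow> X \<subseteq> \<Omega> \<Longrightarrow> gram_form X f f \<le> C) \<Longrightarrow> bounded_gram f"
  by (auto simp: bounded_gram_def)

lemma bounded_gram_cong:
  assumes "\<And>x. x \<in> \<Omega> \<Longrightarrow> f x = g x"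
  shows "bounded_gram f \<longleftrightarrow> bounded_gram g"
proof -
  have "gram_form X f f = gram_form X g g" if "X \<subseteq> \<Omega>" for X
    using that assms by (intro gram_form_cong) auto
  then show ?thesis by (auto simp: bounded_gram_def)
qed

text \<open>Parallelogram law: the discarded term is the nonnegative form of
  \<open>f - g\<close>.\<close>

lemma bounded_gram_add:
  assumes "bounded_gram f" "bounded_gram g"
  shows "bounded_gram (\<lambda>x. f x + g x)"
proof -
  obtain C where C: "\<forall>X. finite X \<and> X \<subseteq> \<Omega> \<longrightarrow> gram_form X f f \<le> C"
    using assms(1) unfolding bounded_gram_def ..
  obtain D where D: "\<forall>X. finite X \<and> X \<subseteq> \<Omega> \<longrightarrow> gram_form X g g \<le> D"
    using assms(2) unfolding bounded_gram_def ..
  show ?thesis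
  proof (rule bounded_gramI)
    fix X assume X: "finite X" "X \<subseteq> \<Omega>"
    show "gram_form X (\<lambda>x. f x + g x) (\<lambda>x. f x + g x) \<le> 2 * C + 2 * D"
      using gram_form_nonneg[OF X, of "\<lambda>x. f x - g x"]
        C[rule_format, OF conjI[OF X]] D[rule_format, OF conjI[OF X]]
      by (simp add: gram_form_add_square[OF X] gram_form_diff_square[OF X])
  qed
qed

lemma bounded_gram_scale:
  assumes "bounded_gram f"
  shows "bounded_gram (\<lambda>x. c * f x)"
proof -
  obtain C where C: "\<forall>X. finite X \<and> X \<subseteq> \<Omega> \<longrightarrow> gram_form X f f \<le> C"
    using assms unfolding bounded_gram_def ..
  show ?thesis
    by (rule bounded_gramI[of _ "c\<^sup>2 * C"]) (simp add: gram_form_scale C mult_left_mono)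
qed

lemma bounded_gram_diff:
  assumes "bounded_gram f" "bounded_gram g"
  shows "bounded_gram (\<lambda>x. f x - g x)"
  using bounded_gram_add[OF assms(1) bounded_gram_scale[OF assms(2), of "- 1"]] by simp

lemma eventually_finite_subset: "\<forall>\<^sub>F X in finite_subsets_at_top \<Omega>. finite X \<and> X \<subseteq> \<Omega>"
  by (rule eventually_finite_subsets_at_top_weakI) auto

text \<open>An increasing bounded net converges to its supremum.\<close>

lemma convergent_gram_form_square:
  assumes "bounded_gram f"
  shows "\<exists>l. ((\<lambda>X. gram_form X f f) \<longlongrightarrow> l) (finite_subsets_at_top \<Omega>)"
proof
  let ?S = "(\<lambda>X. gram_form X f f) ` {X. finite X \<and> X \<subseteq> \<Omega>}"
  have bdd: "bdd_above ?S"
    using assms by (auto simp: bounded_gram_def bdd_above_def)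
  show "((\<lambda>X. gram_form X f f) \<longlongrightarrow> Sup ?S) (finite_subsets_at_top \<Omega>)"
  proof (rule increasing_tendsto)
    show "\<forall>\<^sub>F X in finite_subsets_at_top \<Omega>. gram_form X f f \<le> Sup ?S"
      using eventually_finite_subset by eventually_elim (auto intro!: cSup_upper bdd)
  next
    fix u assume "u < Sup ?S"
    then obtain X where X: "finite X" "X \<subseteq> \<Omega>" "u < gram_form X f f"
      using less_cSup_iff[OF _ bdd] by auto
    then show "\<forall>\<^sub>F Y in finite_subsets_at_top \<Omega>. u < gram_form Y f f"
      unfolding eventually_finite_subsets_at_top
      by (intro exI[of _ X]) (auto intro: less_le_trans gram_form_mono)
  qed
qed

text \<open>Polarization: four times the mixed form is the difference of the forms of
  \<open>f + g\<close> and \<open>f - g\<close>, each of which converges.\<close>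

lemma tendsto_rkhs_ip:
  assumes "bounded_gram f" "bounded_gram g"
  shows "((\<lambda>X. gram_form X f g) \<longlongrightarrow> rkhs_ip f g) (finite_subsets_at_top \<Omega>)"
proof -
  let ?F = "finite_subsets_at_top \<Omega>"
  obtain l m where l: "((\<lambda>X. gram_form X (\<lambda>x. f x + g x) (\<lambda>x. f x + g x)) \<longlongrightarrow> l) ?F"
    and m: "((\<lambda>X. gram_form X (\<lambda>x. f x - g x) (\<lambda>x. f x - g x)) \<longlongrightarrow> m) ?F"
    using convergent_gram_form_square bounded_gram_add[OF assms] bounded_gram_diff[OF assms]
    by blast
  have "((\<lambda>X. (gram_form X (\<lambda>x. f x + g x) (\<lambda>x. f x + g x)
      - gram_form X (\<lambda>x. f x - g x) (\<lambda>x. f x - g x)) / 4) \<longlongrightarrow> (l - m) / 4) ?F"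
    by (intro tendsto_intros l m) simp
  moreover have "\<forall>\<^sub>F X in ?F. (gram_form X (\<lambda>x. f x + g x) (\<lambda>x. f x + g x)
      - gram_form X (\<lambda>x. f x - g x) (\<lambda>x. f x - g x)) / 4 = gram_form X f g"
    using eventually_finite_subset
    by eventually_elim (simp add: gram_form_add_square gram_form_diff_square)
  ultimately have "((\<lambda>X. gram_form X f g) \<longlongrightarrow> (l - m) / 4) ?F"
    by (rule Lim_transform_eventually)
  then show ?thesis
    unfolding rkhs_ip_def by (simp add: tendsto_Lim)
qed

lemma rkhs_ip_eqI:
  assumes "((\<lambda>X. gram_form X f g) \<longlongrightarrow> l) (finite_subsets_at_top \<Omega>)"
  shows "rkhs_ip f g = l"
  unfolding rkhs_ip_def by (rule tendsto_Lim[OF _ assms]) simp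

text \<open>The two nets agree eventually, so \<open>Lim\<close> picks the same value whether or not
  they converge. This lets restrictions to \<open>\<Omega>\<close> be dropped inside the inner
  product.\<close>

lemma rkhs_ip_cong:
  assumes "\<And>x. x \<in> \<Omega> \<Longrightarrow> f x = f' x" "\<And>x. x \<in> \<Omega> \<Longrightarrow> g x = g' x"
  shows "rkhs_ip f g = rkhs_ip f' g'"
proof -
  have "\<forall>\<^sub>F X in finite_subsets_at_top \<Omega>. gram_form X f g = gram_form X f' g'"
    using eventually_finite_subset
    by eventually_elim (auto intro!: gram_form_cong assms)
  then show ?thesis
    unfolding rkhs_ip_def t2_space_class.Lim_def by (simp add: tendsto_cong)
qed

lemma rkhs_ip_commute:
  assumes "bounded_gram f" "bounded_gram g"
  shows "rkhs_ip f g = rkhs_ip g f"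
proof (rule rkhs_ip_eqI)
  have "\<forall>\<^sub>F X in finite_subsets_at_top \<Omega>. gram_form X g f = gram_form X f g"
    using eventually_finite_subset by eventually_elim (simp add: gram_form_sym)
  then show "((\<lambda>X. gram_form X f g) \<longlongrightarrow> rkhs_ip g f) (finite_subsets_at_top \<Omega>)"
    by (rule Lim_transform_eventually[OF tendsto_rkhs_ip[OF assms(2,1)]])
qed

lemma rkhs_ip_add:
  assumes "bounded_gram f" "bounded_gram g" "bounded_gram h"
  shows "rkhs_ip (\<lambda>x. f x + g x) h = rkhs_ip f h + rkhs_ip g h"
  by (rule rkhs_ip_eqI) (auto simp: gram_form_add_left intro!: tendsto_add tendsto_rkhs_ip assms)

lemma rkhs_ip_scale:
  assumes "bounded_gram f" "bounded_gram g"
  shows "rkhs_ip (\<lambda>x. c * f x) g = c * rkhs_ip f g"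
  by (rule rkhs_ip_eqI)
     (auto simp: gram_form_scale_left intro!: tendsto_mult_left tendsto_rkhs_ip assms)

text \<open>The limit of an increasing net dominates each of its members.\<close>

lemma gram_form_le_rkhs_ip:
  assumes "bounded_gram f" "finite X" "X \<subseteq> \<Omega>"
  shows "gram_form X f f \<le> rkhs_ip f f"
proof (rule tendsto_lowerbound[OF tendsto_rkhs_ip[OF assms(1,1)]])
  show "\<forall>\<^sub>F Y in finite_subsets_at_top \<Omega>. gram_form X f f \<le> gram_form Y f f"
    unfolding eventually_finite_subsets_at_top
    using assms by (intro exI[of _ X]) (auto intro: gram_form_mono)
qed simp

lemma rkhs_ip_le:
  assumes "\<And>X. finite X \<Longrightarrow> X \<subseteq> \<Omega> \<Longrightarrow> gram_form X f f \<le> C"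
  shows "rkhs_ip f f \<le> C"
proof (rule tendsto_upperbound[OF tendsto_rkhs_ip])
  show "\<forall>\<^sub>F X in finite_subsets_at_top \<Omega>. gram_form X f f \<le> C"
    using eventually_finite_subset by eventually_elim (use assms in auto)
  show "bounded_gram f" by (rule bounded_gramI) (rule assms)
  then show "bounded_gram f" .
qed simp

text \<open>Boundedness of point evaluation, obtained from the one-point set
  \<open>{x}\<close>.\<close>

lemma square_le_rkhs_ip:
  assumes "bounded_gram f" "x \<in> \<Omega>"
  shows "(f x)\<^sup>2 \<le> K x x * rkhs_ip f f"
  using gram_form_le_rkhs_ip[OF assms(1), of "{x}"] gram_form_singleton[OF assms(2)] assms(2)
  by (simp add: pos_divide_le_eq mult.commute)

text \<open>Bounded point evaluation makes the sequence pointwise Cauchy, with limit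
  \<open>f\<close> on \<open>\<Omega>\<close>. On a finite \<open>X\<close> the form depends
  continuously on finitely many values, so the Cauchy estimate survives the limit with a bound
  uniform in \<open>X\<close>.\<close>

lemma rkhs_complete:
  assumes s: "\<And>n::nat. bounded_gram (s n)"
    and Cauchy: "\<And>e. 0 < e \<Longrightarrow>
      \<exists>M. \<forall>m\<ge>M. \<forall>n\<ge>M. rkhs_ip (\<lambda>x. s m x - s n x) (\<lambda>x. s m x - s n x) < e"
  obtains f where "bounded_gram f"
    and "(\<lambda>n. rkhs_ip (\<lambda>x. s n x - f x) (\<lambda>x. s n x - f x)) \<longlonglongrightarrow> 0"
proof -
  let ?d = "\<lambda>m n x. s m x - s n x"
  have d: "bounded_gram (?d m n)" for m n
    by (rule bounded_gram_diff[OF s s])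
  have conv: "convergent (\<lambda>n. s n x)" if x: "x \<in> \<Omega>" for x
  proof -
    have Kx: "0 < K x x" by (rule gram_form_singleton(1)[OF x])
    have "Cauchy (\<lambda>n. s n x)"
    proof (rule CauchyI)
      fix e :: real assume e: "0 < e"
      \<comment> \<open>The factor \<open>K x x\<close> in the evaluation bound turns this threshold
        into \<open>e\<^sup>2\<close>.\<close>
      obtain M where M: "\<And>m n. m \<ge> M \<Longrightarrow> n \<ge> M \<Longrightarrow> rkhs_ip (?d m n) (?d m n) < e\<^sup>2 / K x x"
        using Cauchy[of "e\<^sup>2 / K x x"] e Kx by auto
      have "norm (s m x - s n x) < e" if "m \<ge> M" "n \<ge> M" for m n
      proof -
        have "(s m x - s n x)\<^sup>2 \<le> K x x * rkhs_ip (?d m n) (?d m n)"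
          by (rule square_le_rkhs_ip[OF d x])
        also have "\<dots> < e\<^sup>2"
          using M[OF that] Kx by (simp add: pos_less_divide_eq mult.commute)
        finally show ?thesis
          using e by (intro power2_less_imp_less[of _ e]) simp_all
      qed
      then show "\<exists>M. \<forall>m\<ge>M. \<forall>n\<ge>M. norm (s m x - s n x) < e" by blast
    qed
    then show ?thesis by (rule Cauchy_convergent)
  qed
  define f where "f x = lim (\<lambda>n. s n x)" for x
  have lim: "(\<lambda>n. s n x) \<longlonglongrightarrow> f x" if "x \<in> \<Omega>" for x
    using conv[OF that] by (simp add: f_def convergent_LIMSEQ_iff)
  \<comment> \<open>\<open>M\<close> is chosen before \<open>X\<close>; this uniformity is what
    carries the bound over to the norm.\<close>
  have near: "\<exists>M. \<forall>n\<ge>M. \<forall>X. finite X \<and> X \<subseteq> \<Omega>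
      \<longrightarrow> gram_form X (\<lambda>x. s n x - f x) (\<lambda>x. s n x - f x) \<le> e" if e: "0 < e" for e
  proof -
    obtain M where M: "\<And>m n. m \<ge> M \<Longrightarrow> n \<ge> M \<Longrightarrow> rkhs_ip (?d m n) (?d m n) < e"
      using Cauchy[OF e] by blast
    have "gram_form X (\<lambda>x. s n x - f x) (\<lambda>x. s n x - f x) \<le> e"
      if n: "n \<ge> M" and X: "finite X" "X \<subseteq> \<Omega>" for n X
    proof (rule LIMSEQ_le_const2)
      show "(\<lambda>m. gram_form X (?d n m) (?d n m))
          \<longlonglongrightarrow> gram_form X (\<lambda>x. s n x - f x) (\<lambda>x. s n x - f x)"
        using X by (intro tendsto_gram_form tendsto_diff tendsto_const lim) auto
      show "\<exists>N. \<forall>m\<ge>N. gram_form X (?d n m) (?d n m) \<le> e"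
        using M[OF n] gram_form_le_rkhs_ip[OF d X]
        by (intro exI[of _ M]) (meson le_less_trans less_imp_le)
    qed
    then show ?thesis by blast
  qed
  have bnd: "bounded_gram f"
  proof -
    have one: "0 < (1 :: real)" by simp
    obtain M where M: "\<forall>n\<ge>M. \<forall>X. finite X \<and> X \<subseteq> \<Omega>
        \<longrightarrow> gram_form X (\<lambda>x. s n x - f x) (\<lambda>x. s n x - f x) \<le> 1"
      using near[of "1 :: real", OF one] ..
    have "bounded_gram (\<lambda>x. s M x - f x)"
      by (rule bounded_gramI[of _ 1]) (simp add: M)
    \<comment> \<open>Here \<open>f\<close> is written as \<open>s M - (s M - f)\<close>.\<close>
    from bounded_gram_diff[OF s[of M] this] show ?thesis by simp
  qed
  have "(\<lambda>n. rkhs_ip (\<lambda>x. s n x - f x) (\<lambda>x. s n x - f x)) \<longlonglongrightarrow> 0"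
  proof (rule LIMSEQ_I)
    fix e :: real assume e: "0 < e"
    \<comment> \<open>Only weak inequalities survive the limit; halving \<open>e\<close> restores a
      strict one.\<close>
    obtain M where M: "\<And>n X. n \<ge> M \<Longrightarrow> finite X \<Longrightarrow> X \<subseteq> \<Omega>
        \<Longrightarrow> gram_form X (\<lambda>x. s n x - f x) (\<lambda>x. s n x - f x) \<le> e / 2"
      using near[of "e / 2"] e by auto
    have "norm (rkhs_ip (\<lambda>x. s n x - f x) (\<lambda>x. s n x - f x) - 0) < e" if n: "n \<ge> M" for n
    proof -
      have "rkhs_ip (\<lambda>x. s n x - f x) (\<lambda>x. s n x - f x) \<le> e / 2"
        by (rule rkhs_ip_le) (rule M[OF n])
      moreover have "0 \<le> rkhs_ip (\<lambda>x. s n x - f x) (\<lambda>x. s n x - f x)"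
        using gram_form_le_rkhs_ip[OF bounded_gram_diff[OF s[of n] bnd], of "{}"]
        by (simp add: gram_form_def)
      ultimately show ?thesis using e by simp
    qed
    then show "\<exists>N. \<forall>n\<ge>N. norm (rkhs_ip (\<lambda>x. s n x - f x) (\<lambda>x. s n x - f x) - 0) < e"
      by blast
  qed
  with bnd show thesis by (rule that)
qed

text \<open>The section \<open>K(\<cdot>, y)\<close> is interpolated by the coefficient 1 at
  \<open>y\<close> and 0 elsewhere. This is the reproducing property on a finite set.\<close>

lemma gram_form_kernel:
  assumes "finite X" "X \<subseteq> \<Omega>" "y \<in> X"
  shows "gram_form X f (\<lambda>z. K z y) = f y"
  using assms
  by (subst gram_form_eq[where c = "\<lambda>z. if z = y then 1 else 0"])
     (auto simp: kernel_comb_def if_distrib[of "\<lambda>u. u * _"] if_distrib[of "\<lambda>u. _ * u"] cong: if_cong)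

text \<open>Adding \<open>y\<close> to \<open>X\<close> can only increase the form, and then the
  finite reproducing property evaluates it.\<close>

lemma bounded_gram_kernel:
  assumes "y \<in> \<Omega>"
  shows "bounded_gram (\<lambda>z. K z y)"
proof (rule bounded_gramI)
  fix X assume X: "finite X" "X \<subseteq> \<Omega>"
  have "gram_form X (\<lambda>z. K z y) (\<lambda>z. K z y)
      \<le> gram_form (insert y X) (\<lambda>z. K z y) (\<lambda>z. K z y)"
    using X assms by (intro gram_form_mono) auto
  also have "\<dots> = K y y"
    using X assms by (intro gram_form_kernel) auto
  finally show "gram_form X (\<lambda>z. K z y) (\<lambda>z. K z y) \<le> K y y" .
qed

text \<open>The net is constant as soon as \<open>y\<close> belongs to \<open>X\<close>.\<close>

lemma rkhs_ip_kernel: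
  assumes "y \<in> \<Omega>"
  shows "rkhs_ip f (\<lambda>z. K z y) = f y"
proof (rule rkhs_ip_eqI)
  have "\<forall>\<^sub>F X in finite_subsets_at_top \<Omega>. f y = gram_form X f (\<lambda>z. K z y)"
    unfolding eventually_finite_subsets_at_top
    using assms by (intro exI[of _ "{y}"]) (auto simp: gram_form_kernel)
  then show "((\<lambda>X. gram_form X f (\<lambda>z. K z y)) \<longlongrightarrow> f y) (finite_subsets_at_top \<Omega>)"
    by (rule Lim_transform_eventually[OF tendsto_const])
qed

lemma rkhs_ip_restrict: "rkhs_ip (restrict f \<Omega>) g = rkhs_ip f g"
  "rkhs_ip f (restrict g \<Omega>) = rkhs_ip f g"
  by (auto intro: rkhs_ip_cong)

lemma restrict_in_rkhs: "bounded_gram f \<Longrightarrow> restrict f \<Omega> \<in> rkhs"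
  by (simp add: rkhs_def bounded_gram_cong[of "restrict f \<Omega>" f])

theorem is_rkhs_rkhs: "is_rkhs \<Omega> K rkhs rkhs_ip"
  unfolding is_rkhs_def hilbert_function_space_def Let_def rkhs_ip_restrict
proof (intro conjI ballI allI impI)
  show "rkhs \<subseteq> extensional \<Omega>" by (auto simp: rkhs_def)
  have "bounded_gram (\<lambda>_. 0)"
    by (rule bounded_gramI[of _ 0]) (simp add: gram_form_def)
  then show "(\<lambda>x\<in>\<Omega>. 0) \<in> rkhs" by (rule restrict_in_rkhs)
next
  fix f g assume "f \<in> rkhs" "g \<in> rkhs"
  then have fg: "bounded_gram f" "bounded_gram g" by (auto simp: rkhs_def)
  show "(\<lambda>x\<in>\<Omega>. f x + g x) \<in> rkhs"
    by (intro restrict_in_rkhs bounded_gram_add fg)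
  show "rkhs_ip f g = rkhs_ip g f"
    by (rule rkhs_ip_commute[OF fg])
  show "rkhs_ip (\<lambda>x. c * f x) g = c * rkhs_ip f g" for c
    by (rule rkhs_ip_scale[OF fg])
  show "rkhs_ip (\<lambda>x. f x + g x) h = rkhs_ip f h + rkhs_ip g h" if "h \<in> rkhs" for h
    using that by (intro rkhs_ip_add fg) (auto simp: rkhs_def)
next
  fix c f assume "f \<in> rkhs"
  then show "(\<lambda>x\<in>\<Omega>. c * f x) \<in> rkhs"
    by (intro restrict_in_rkhs bounded_gram_scale) (auto simp: rkhs_def)
next
  fix f assume f: "f \<in> rkhs" "f \<noteq> (\<lambda>x\<in>\<Omega>. 0)"
  have "\<exists>x\<in>\<Omega>. f x \<noteq> 0"
  proof (rule ccontr)
    assume "\<not> (\<exists>x\<in>\<Omega>. f x \<noteq> 0)"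
    then have "f = (\<lambda>x\<in>\<Omega>. 0)"
      using f(1) by (intro extensionalityI[of _ \<Omega>]) (auto simp: rkhs_def)
    with f(2) show False by simp
  qed
  then obtain x where x: "x \<in> \<Omega>" "f x \<noteq> 0" by blast
  have "0 < (f x)\<^sup>2" using x by simp
  also have "\<dots> \<le> K x x * rkhs_ip f f"
    using f(1) x(1) by (intro square_le_rkhs_ip) (auto simp: rkhs_def)
  finally show "0 < rkhs_ip f f"
    using gram_form_singleton(1)[OF x(1)] by (simp add: zero_less_mult_iff)
next
  fix s :: "nat \<Rightarrow> 'a \<Rightarrow> real"
  let ?q = "\<lambda>f. rkhs_ip f f"
  assume "(\<forall>n. s n \<in> rkhs) \<and>
    (\<forall>e>0. \<exists>M. \<forall>m\<ge>M. \<forall>n\<ge>M. sqrt (?q (\<lambda>x. s m x - s n x)) < e)"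
  then have s: "bounded_gram (s n)"
    and Cauchy: "0 < e \<Longrightarrow> \<exists>M. \<forall>m\<ge>M. \<forall>n\<ge>M. sqrt (?q (\<lambda>x. s m x - s n x)) < e" for n e
    by (auto simp: rkhs_def)
  \<comment> \<open>Distances in \<open>hilbert_function_space\<close> are square roots, those in
    \<open>rkhs_complete\<close> their squares.\<close>
  have Cauchy': "\<exists>M. \<forall>m\<ge>M. \<forall>n\<ge>M. ?q (\<lambda>x. s m x - s n x) < e" if "0 < e" for e
    using Cauchy[of "sqrt e"] that by simp
  obtain f where f: "bounded_gram f" "(\<lambda>n. ?q (\<lambda>x. s n x - f x)) \<longlonglongrightarrow> 0"
    using rkhs_complete[OF s Cauchy'] by blast
  have "(\<lambda>n. sqrt (?q (\<lambda>x. s n x - f x))) \<longlonglongrightarrow> 0"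
    using tendsto_real_sqrt[OF f(2)] by simp
  moreover have "?q (\<lambda>x. s n x - restrict f \<Omega> x) = ?q (\<lambda>x. s n x - f x)" for n
    by (rule rkhs_ip_cong) auto
  ultimately show "\<exists>f\<in>rkhs. (\<lambda>n. sqrt (?q (\<lambda>x. s n x - f x))) \<longlonglongrightarrow> 0"
    using restrict_in_rkhs[OF f(1)] by (intro bexI[of _ "restrict f \<Omega>"]) auto
next
  fix y assume "y \<in> \<Omega>"
  then show "(\<lambda>z\<in>\<Omega>. K z y) \<in> rkhs"
    by (intro restrict_in_rkhs bounded_gram_kernel)
next
  fix y f assume "y \<in> \<Omega>" "f \<in> rkhs"
  then show "rkhs_ip f (\<lambda>z. K z y) = f y" by (simp add: rkhs_ip_kernel)
qed

text \<open>Linearity and the reproducing property force these inner products in every reproducing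
  kernel Hilbert space of \<open>K\<close>, so the norm of a kernel combination is the same in all
  of them.\<close>

lemma is_rkhs_kernel_comb:
  assumes "is_rkhs \<Omega> K H ip" "finite X" "X \<subseteq> \<Omega>"
  shows "restrict (kernel_comb K c X) \<Omega> \<in> H \<and>
    (\<forall>g\<in>H. ip (restrict (kernel_comb K c X) \<Omega>) g = (\<Sum>y\<in>X. c y * g y))"
  using assms(2,3)
proof (induction X)
  have H: "hilbert_function_space \<Omega> H ip" using assms(1) by (simp add: is_rkhs_def)
  let ?k = "\<lambda>y. \<lambda>z\<in>\<Omega>. K z y"
  have zero: "(\<lambda>x\<in>\<Omega>. 0) \<in> H"
    and add: "\<And>f g. f \<in> H \<Longrightarrow> g \<in> H \<Longrightarrow> (\<lambda>x\<in>\<Omega>. f x + g x) \<in> H"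
    and scale: "\<And>c f. f \<in> H \<Longrightarrow> (\<lambda>x\<in>\<Omega>. c * f x) \<in> H"
    and ip_commute: "\<And>f g. f \<in> H \<Longrightarrow> g \<in> H \<Longrightarrow> ip f g = ip g f"
    and ip_add: "\<And>f g h. f \<in> H \<Longrightarrow> g \<in> H \<Longrightarrow> h \<in> H \<Longrightarrow>
      ip (\<lambda>x\<in>\<Omega>. f x + g x) h = ip f h + ip g h"
    and ip_scale: "\<And>c f g. f \<in> H \<Longrightarrow> g \<in> H \<Longrightarrow> ip (\<lambda>x\<in>\<Omega>. c * f x) g = c * ip f g"
    using H unfolding hilbert_function_space_def by (elim conjE, blast)+
  have k: "?k y \<in> H" "\<And>f. f \<in> H \<Longrightarrow> ip f (?k y) = f y" if "y \<in> \<Omega>" for y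
    using assms(1) that unfolding is_rkhs_def by simp_all
  {
    case empty
    have "ip (\<lambda>x\<in>\<Omega>. 0) g = 0" if "g \<in> H" for g
      using ip_scale[OF zero that, of 0] by (simp cong: restrict_cong)
    moreover have "restrict (kernel_comb K c {}) \<Omega> = (\<lambda>x\<in>\<Omega>. 0)"
      by (simp add: kernel_comb_def restrict_def fun_eq_iff)
    ultimately show ?case using zero by (metis sum.empty)
  next
    case (insert x X)
    let ?r = "restrict (kernel_comb K c X) \<Omega>"
    have x: "x \<in> \<Omega>" and X: "X \<subseteq> \<Omega>" using insert.prems by auto
    have IH: "?r \<in> H" "\<And>g. g \<in> H \<Longrightarrow> ip ?r g = (\<Sum>y\<in>X. c y * g y)"
      using insert.IH[OF X] by blast+
    have eq: "restrict (kernel_comb K c (insert x X)) \<Omega>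
        = (\<lambda>z\<in>\<Omega>. (\<lambda>z\<in>\<Omega>. c x * ?k x z) z + ?r z)"
      using insert(1,2) by (auto simp: kernel_comb_def fun_eq_iff restrict_def)
    have cx: "(\<lambda>z\<in>\<Omega>. c x * ?k x z) \<in> H" by (rule scale[OF k(1)[OF x]])
    have "ip (\<lambda>z\<in>\<Omega>. c x * ?k x z) g = c x * g x" if "g \<in> H" for g
      using ip_scale[OF k(1)[OF x] that] ip_commute[OF k(1)[OF x] that] k(2)[OF x that] by simp
    then have "ip (\<lambda>z\<in>\<Omega>. (\<lambda>z\<in>\<Omega>. c x * ?k x z) z + ?r z) g = (\<Sum>y\<in>insert x X. c y * g y)"
      if "g \<in> H" for g
      using that insert.hyps by (simp only: ip_add[OF cx IH(1)] IH(2) sum.insert) simp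
    then show ?case
      unfolding eq using add[OF cx IH(1)] by blast
  }
qed

text \<open>The description in \<open>rkhs_norm\<close> has a witness because \<open>rkhs\<close> is
  such a space, and a unique one because all such spaces give \<open>f\<close> the same
  norm.\<close>

lemma rkhs_norm_kernel_comb:
  assumes "finite X" "X \<subseteq> \<Omega>" "\<And>z. z \<in> \<Omega> \<Longrightarrow> f z = kernel_comb K c X z"
  shows "(rkhs_norm \<Omega> K f)\<^sup>2 = (\<Sum>y\<in>X. c y * kernel_comb K c X y)"
proof -
  let ?f = "restrict f \<Omega>"
  have f: "?f = restrict (kernel_comb K c X) \<Omega>"
    using assms(3) by (rule restrict_ext)
  have mem: "?f \<in> H" and ip: "ip ?f ?f = (\<Sum>y\<in>X. c y * kernel_comb K c X y)"
    if "is_rkhs \<Omega> K H ip" for H ip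
  proof -
    show mem: "?f \<in> H"
      using is_rkhs_kernel_comb[OF that assms(1,2), of c] unfolding f by blast
    have "ip ?f ?f = (\<Sum>y\<in>X. c y * ?f y)"
      using is_rkhs_kernel_comb[OF that assms(1,2), of c] mem unfolding f by blast
    also have "\<dots> = (\<Sum>y\<in>X. c y * kernel_comb K c X y)"
      using assms(2) unfolding f by (intro sum.cong) auto
    finally show "ip ?f ?f = (\<Sum>y\<in>X. c y * kernel_comb K c X y)" .
  qed
  have "rkhs_norm \<Omega> K f = sqrt (\<Sum>y\<in>X. c y * kernel_comb K c X y)"
    unfolding rkhs_norm_def
  proof (rule the_equality)
    show "\<exists>H ip. is_rkhs \<Omega> K H ip \<and> ?f \<in> H \<and>
        sqrt (\<Sum>y\<in>X. c y * kernel_comb K c X y) = sqrt (ip ?f ?f)"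
      using is_rkhs_rkhs mem[OF is_rkhs_rkhs] ip[OF is_rkhs_rkhs] by metis
  qed (use ip in auto)
  then show ?thesis
    using energy_nonneg[OF assms(1,2), of c] by simp
qed


section \<open>Conditional means and variances\<close>

text \<open>The coefficients are \<open>K(X)\<^sup>-\<^sup>1 f(X)\<close>; the default 0 for the
  empty list agrees with the empty sum.\<close>

lemma cond_mean_interpolates:
  assumes "distinct L" "set L \<subseteq> \<Omega>"
  obtains c where "\<And>x. cond_mean K f L x = kernel_comb K c (set L) x"
    and "\<And>z. z \<in> set L \<Longrightarrow> kernel_comb K c (set L) z = f z"
proof -
  obtain c where c: "kernel_mat_inv K L *\<^sub>v fun_vec f L = fun_vec c L"
    "\<And>z. z \<in> set L \<Longrightarrow> kernel_comb K c (set L) z = f z"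
    using kernel_mat_inv_interpolates[OF assms] by metis
  have "cond_mean K f L x = kernel_comb K c (set L) x" for x
    using assms(1)
    by (cases "L = []") (simp_all add: cond_mean_def c(1) fun_vec_scalar_prod kernel_comb_def mult.commute)
  with c(2) show thesis by (rule that[rotated])
qed

text \<open>The squared norm is \<open>c\<^sup>T K(X) c\<close>, and \<open>K(X) c = f(X)\<close>
  since the conditional mean interpolates \<open>f\<close>.\<close>

lemma rkhs_norm_cond_mean:
  assumes "distinct L" "set L \<subseteq> \<Omega>"
  shows "(rkhs_norm \<Omega> K (cond_mean K f L))\<^sup>2 = gram_form (set L) f f"
proof -
  obtain c where c: "\<And>x. cond_mean K f L x = kernel_comb K c (set L) x"
    "\<And>z. z \<in> set L \<Longrightarrow> kernel_comb K c (set L) z = f z"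
    using cond_mean_interpolates[OF assms, of f] by metis
  have "(rkhs_norm \<Omega> K (cond_mean K f L))\<^sup>2 = (\<Sum>y\<in>set L. c y * kernel_comb K c (set L) y)"
    by (rule rkhs_norm_kernel_comb) (simp_all add: assms(2) c(1))
  also have "\<dots> = gram_form (set L) f f"
    using assms by (simp add: gram_form_eq[where c = c] c(2) mult.commute)
  finally show ?thesis .
qed

lemma cond_var_gram:
  assumes "distinct L" "set L \<subseteq> \<Omega>"
  shows "cond_var K L p = K p p - gram_form (set L) (K p) (K p)"
  using gram_form_list[OF assms] by (cases "L = []") (simp_all add: cond_var_def gram_form_def)

text \<open>The conditional variance is the squared norm of the residual
  \<open>K(\<cdot>, p) - \<Sum>y. c y * K(\<cdot>, y)\<close>.\<close>

lemma cond_var_pos: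
  assumes "distinct L" "set L \<subseteq> \<Omega>" "p \<in> \<Omega>" "p \<notin> set L"
  shows "0 < cond_var K L p"
proof -
  define c where "c = interpolant (set L) (K p)"
  \<comment> \<open>Coefficients of the residual; the entry 1 at \<open>p\<close> makes them
    nonzero.\<close>
  define a where "a y = (if y = p then 1 else - c y)" for y
  have comb: "kernel_comb K a (insert p (set L)) z = K z p - kernel_comb K c (set L) z" for z
  proof -
    have "(\<Sum>y\<in>set L. a y * K z y) = (\<Sum>y\<in>set L. - (c y * K z y))"
      using assms(4) by (intro sum.cong) (auto simp: a_def)
    then show ?thesis
      using assms(4) by (simp add: kernel_comb_def a_def sum_negf)
  qed
  have zero: "kernel_comb K a (insert p (set L)) z = 0" if "z \<in> set L" for z
    using that assms(2,3) kernel_comb_interpolant[of "set L" z "K p"] kernel_sym[of z p]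
    by (auto simp: comb c_def)
  have "0 < (\<Sum>z\<in>insert p (set L). a z * kernel_comb K a (insert p (set L)) z)"
    using assms by (intro energy_pos[where x = p]) (auto simp: a_def)
  \<comment> \<open>The residual vanishes on \<open>L\<close>, so only the term at \<open>p\<close>
    remains.\<close>
  also have "\<dots> = kernel_comb K a (insert p (set L)) p"
    using assms(4) zero by (simp add: a_def)
  also have "\<dots> = cond_var K L p"
    unfolding comb
    by (simp add: cond_var_gram[OF assms(1,2)] gram_form_def c_def kernel_comb_def mult.commute)
  finally show ?thesis .
qed

text \<open>One step of block elimination: the conditional variance is the Schur complement of
  \<open>K(L)\<close> in the matrix bordered by \<open>p\<close>.\<close>

lemma det_kernel_mat_snoc:
  assumes "distinct L" "set L \<subseteq> \<Omega>" "p \<in> \<Omega>"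
  shows "det (kernel_mat K (L @ [p])) = det (kernel_mat K L) * cond_var K L p"
proof -
  let ?n = "length L"
  define c where "c = interpolant (set L) (K p)"
  have c: "(\<Sum>i<?n. c (L ! i) * K (L ! j) (L ! i)) = K (L ! j) p" if "j < ?n" for j
  proof -
    have "L ! j \<in> set L" using that by simp
    moreover from this have "L ! j \<in> \<Omega>" using assms(2) by blast
    ultimately have "kernel_comb K c (set L) (L ! j) = K (L ! j) p"
      using assms(2,3) by (simp add: c_def kernel_comb_interpolant kernel_sym)
    then show ?thesis by (simp add: kernel_comb_def sum_set_conv_nth[OF assms(1)])
  qed
  have V: "cond_var K L p = K p p - (\<Sum>i<?n. K p (L ! i) * c (L ! i))"
    by (simp add: cond_var_gram[OF assms(1,2)] gram_form_def c_def sum_set_conv_nth[OF assms(1)])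
  define b where "b = mat ?n 1 (\<lambda>(i, _). K (L ! i) p)"
  define b' where "b' = mat 1 ?n (\<lambda>(_, j). K p (L ! j))"
  define d where "d = mat 1 1 (\<lambda>_. K p p)"
  define u where "u = mat ?n 1 (\<lambda>(i, _). - c (L ! i))"
  \<comment> \<open>\<open>U\<close> has determinant 1. Multiplying by it on the right subtracts
    from the last column the combination of the others with coefficients \<open>c\<close>, which
    clears the upper right block.\<close>
  define U where "U = four_block_mat (1\<^sub>m ?n) u (0\<^sub>m 1 ?n) (1\<^sub>m 1)"
  have carrier: "b \<in> carrier_mat ?n 1" "b' \<in> carrier_mat 1 ?n" "d \<in> carrier_mat 1 1"
      "u \<in> carrier_mat ?n 1"
    by (auto simp: b_def b'_def d_def u_def)
  have block: "kernel_mat K (L @ [p]) = four_block_mat (kernel_mat K L) b b' d"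
    by (rule eq_matI)
       (auto simp: kernel_mat_def b_def b'_def d_def nth_append less_Suc_eq)
  have "kernel_mat K (L @ [p]) * U
    = four_block_mat (kernel_mat K L * 1\<^sub>m ?n + b * 0\<^sub>m 1 ?n) (kernel_mat K L * u + b * 1\<^sub>m 1)
        (b' * 1\<^sub>m ?n + d * 0\<^sub>m 1 ?n) (b' * u + d * 1\<^sub>m 1)"
    unfolding block U_def by (rule mult_four_block_mat[OF kernel_mat_carrier carrier(1-3) one_carrier_mat carrier(4)
        zero_carrier_mat one_carrier_mat])
  also have "\<dots> = four_block_mat (kernel_mat K L) (0\<^sub>m ?n 1) b' (mat 1 1 (\<lambda>_. cond_var K L p))"
  proof (rule cong_four_block_mat)
    show "kernel_mat K L * 1\<^sub>m ?n + b * 0\<^sub>m 1 ?n = kernel_mat K L"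
      using right_mult_one_mat[OF kernel_mat_carrier] right_mult_zero_mat[OF carrier(1)]
        right_add_zero_mat[OF kernel_mat_carrier] by metis
    show "b' * 1\<^sub>m ?n + d * 0\<^sub>m 1 ?n = b'"
      using right_mult_one_mat[OF carrier(2)] right_mult_zero_mat[OF carrier(3)]
        right_add_zero_mat[OF carrier(2)] by metis
    show "kernel_mat K L * u + b * 1\<^sub>m 1 = 0\<^sub>m ?n 1"
      using carrier(1) c
      by (intro eq_matI)
         (auto simp: kernel_mat_def b_def u_def scalar_prod_def atLeast0LessThan sum_negf mult.commute)
    show "b' * u + d * 1\<^sub>m 1 = mat 1 1 (\<lambda>_. cond_var K L p)"
      using carrier(3)
      by (intro eq_matI)
         (auto simp: V b'_def d_def u_def scalar_prod_def atLeast0LessThan sum_negf)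
  qed
  finally have "det (kernel_mat K (L @ [p]) * U) = det (kernel_mat K L) * cond_var K L p"
    by (simp only: det_four_block_mat_upper_right_zero[OF kernel_mat_carrier refl carrier(2) mat_carrier])
       (simp add: det_single)
  moreover have "det (kernel_mat K (L @ [p]) * U) = det (kernel_mat K (L @ [p])) * det U"
    using kernel_mat_carrier[of K "L @ [p]"] carrier(4)
    by (intro det_mult[of _ "?n + 1"]) (auto simp: U_def)
  moreover have "det U = 1"
    unfolding U_def
    by (simp only: det_four_block_mat_lower_left_zero[OF one_carrier_mat carrier(4) refl one_carrier_mat])
       simp
  ultimately show ?thesis by simp
qed

end

section \<open>Initial segments of the sequence and the two losses\<close>

lemma first_pts_0 [simp]: "first_pts x 0 = []"
  by (simp add: first_pts_def)

lemma first_pts_Suc: "first_pts x (Suc n) = first_pts x n @ [x (Suc n)]"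
  by (simp add: first_pts_def)

lemma set_first_pts: "set (first_pts x n) = x ` {1..n}"
  by (auto simp: first_pts_def)

lemma distinct_first_pts:
  assumes "inj_on x {1..}"
  shows "distinct (first_pts x n)"
  using assms by (auto simp: first_pts_def distinct_map intro: inj_on_subset)

context pd_kernel
begin

context
  fixes x :: "nat \<Rightarrow> 'a"
  assumes x_in: "x ` {1..} \<subseteq> \<Omega>" and inj: "inj_on x {1..}"
begin

lemma first_pts_subset: "set (first_pts x n) \<subseteq> \<Omega>"
  using x_in by (auto simp: set_first_pts)

lemma cond_var_first_pts_pos:
  assumes "1 \<le> i"
  shows "0 < cond_var K (first_pts x (i - 1)) (x i)"
proof (rule cond_var_pos)
  show "x i \<notin> set (first_pts x (i - 1))"
  proof
    assume "x i \<in> set (first_pts x (i - 1))"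
    then obtain j where "x i = x j" "1 \<le> j" "j \<le> i - 1" by (auto simp: set_first_pts)
    with inj_onD[OF inj, of i j] assms show False by simp
  qed
qed (use assms x_in in \<open>auto intro: distinct_first_pts inj first_pts_subset[THEN subsetD]\<close>)

text \<open>Iterates the bordering step; the factor for \<open>i = 1\<close> conditions on the empty
  list and is \<open>K (x 1) (x 1)\<close>.\<close>

lemma det_first_pts:
  "det (kernel_mat K (first_pts x n)) = (\<Prod>i=1..n. cond_var K (first_pts x (i - 1)) (x i))"
proof (induction n)
  case 0
  show ?case using kernel_mat_carrier[of K "[]"] by simp
next
  case (Suc n)
  have "x (Suc n) \<in> \<Omega>" using x_in by auto
  then show ?case
    using det_kernel_mat_snoc[OF distinct_first_pts[OF inj] first_pts_subset, of "x (Suc n)" n] Suc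
    by (simp add: first_pts_Suc)
qed

text \<open>Positivity of the conditional variances lets the logarithm turn the product formula for
  the determinant into a sum.\<close>

lemma ml_loss_first_pts:
  "ml_loss K f (first_pts x n) = gram_form (set (first_pts x n)) f f
    + (\<Sum>i=1..n. ln (cond_var K (first_pts x (i - 1)) (x i)))"
proof -
  have "ln (det (kernel_mat K (first_pts x n)))
      = (\<Sum>i=1..n. ln (cond_var K (first_pts x (i - 1)) (x i)))"
    unfolding det_first_pts
    by (rule ln_prod) (use cond_var_first_pts_pos in force)+
  then show ?thesis
    by (simp add: ml_loss_def gram_form_list[OF distinct_first_pts[OF inj] first_pts_subset])
qed

lemma cond_var_removeAll_pos:
  assumes "1 \<le> i"
  shows "0 < cond_var K (removeAll (x i) (first_pts x n)) (x i)"
proof (rule cond_var_pos)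
  show "distinct (removeAll (x i) (first_pts x n))"
    using distinct_first_pts[OF inj, of n] by (rule distinct_removeAll)
qed (use assms x_in first_pts_subset[of n] in auto)

lemma cv_loss_first_pts:
  "cv_loss K f (first_pts x n) = (\<Sum>i=1..n.
      (f (x i) - cond_mean K f (removeAll (x i) (first_pts x n)) (x i))\<^sup>2
        / cond_var K (removeAll (x i) (first_pts x n)) (x i)
      + ln (cond_var K (removeAll (x i) (first_pts x n)) (x i)))"
proof -
  have "inj_on x {1..n}"
    using inj by (rule inj_on_subset) auto
  then show ?thesis
    unfolding cv_loss_def set_first_pts by (simp add: sum.reindex)
qed

end

end

section \<open>Minimisers of the losses\<close>

text \<open>The common core of both claims. Once the double supremum is negative, so is
  \<open>bound\<close> at an estimate lying in \<open>\<Delta>\<close>; then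
  \<open>\<theta>0\<close> has strictly smaller loss than this minimiser, a contradiction.\<close>

lemma eventually_minimizer_notin:
  fixes bound :: "nat \<Rightarrow> 't \<Rightarrow> 'f \<Rightarrow> real" and loss :: "'t \<Rightarrow> 'f \<Rightarrow> nat \<Rightarrow> real"
  assumes limsup: "limsup (\<lambda>n. SUP \<theta>\<in>\<Delta>. SUP f\<in>B. ereal (bound n \<theta> f)) < 0"
    and excess: "\<And>n \<theta> f. \<theta> \<in> \<Delta> \<Longrightarrow> loss \<theta>0 f n - loss \<theta> f n \<le> bound n \<theta> f"
    and min: "\<And>n f. f \<in> B \<Longrightarrow> 1 \<le> n \<Longrightarrow> is_arg_min (\<lambda>\<theta>. loss \<theta> f n) (\<lambda>\<theta>. \<theta> \<in> \<Theta>) (est f n)"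
    and "\<theta>0 \<in> \<Theta>"
  shows "\<exists>N. \<forall>f\<in>B. \<forall>n\<ge>N. est f n \<notin> \<Delta>"
proof -
  obtain N where N: "\<And>n. n \<ge> N \<Longrightarrow> (SUP \<theta>\<in>\<Delta>. SUP f\<in>B. ereal (bound n \<theta> f)) < 0"
    using Limsup_lessD[OF limsup] by (auto simp: eventually_sequentially)
  \<comment> \<open>Estimates are assumed to minimise only for \<open>n\<close> at least 1.\<close>
  have "est f n \<notin> \<Delta>" if f: "f \<in> B" and n: "n \<ge> max 1 N" for f n
  proof
    assume \<Delta>: "est f n \<in> \<Delta>"
    have "ereal (bound n (est f n) f) \<le> (SUP g\<in>B. ereal (bound n (est f n) g))"
      using f by (rule SUP_upper)
    also have "\<dots> \<le> (SUP \<theta>\<in>\<Delta>. SUP f\<in>B. ereal (bound n \<theta> f))"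
      using \<Delta> by (rule SUP_upper)
    also have "\<dots> < 0" using N n by simp
    finally have "bound n (est f n) f < 0" by simp
    with excess[OF \<Delta>, of f n] have "loss \<theta>0 f n < loss (est f n) f n" by linarith
    with min[OF f, of n] n \<open>\<theta>0 \<in> \<Theta>\<close> show False
      by (auto simp: is_arg_min_def)
  qed
  then show ?thesis by blast
qed

theorem theorem2p3:
  fixes \<Omega> :: "'a set" and \<Theta> \<Delta> :: "'t set" and \<theta>0 :: 't
    and K :: "'t \<Rightarrow> 'a \<Rightarrow> 'a \<Rightarrow> real" and x :: "nat \<Rightarrow> 'a"
  assumes "infinite \<Omega>"
    and "\<forall>\<theta>\<in>\<Theta>. sympd_kernel \<Omega> (K \<theta>)"
    and "x ` {1..} \<subseteq> \<Omega>" and "inj_on x {1..}"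
    and "\<Delta> \<subseteq> \<Theta>" and "\<theta>0 \<in> \<Theta>"
  shows
    "(\<forall>(B :: ('a \<Rightarrow> real) set) (\<theta>ML :: ('a \<Rightarrow> real) \<Rightarrow> 'a list \<Rightarrow> 't).
        (\<forall>f0\<in>B. \<forall>n\<ge>1. is_arg_min (\<lambda>\<theta>. ml_loss (K \<theta>) f0 (first_pts x n)) (\<lambda>\<theta>. \<theta> \<in> \<Theta>)
                                  (\<theta>ML f0 (first_pts x n))) \<longrightarrow>
        limsup (\<lambda>n. SUP \<theta>\<in>\<Delta>. SUP f0\<in>B. ereal (
            (rkhs_norm \<Omega> (K \<theta>0) (cond_mean (K \<theta>0) f0 (first_pts x n)))\<^sup>2
            + (\<Sum>i=1..n. ln (cond_var (K \<theta>0) (first_pts x (i - 1)) (x i)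
                             / cond_var (K \<theta>) (first_pts x (i - 1)) (x i))))) < 0 \<longrightarrow>
        (\<exists>N. \<forall>f0\<in>B. \<forall>n\<ge>N. \<theta>ML f0 (first_pts x n) \<notin> \<Delta>))
     \<and>
     (\<forall>(B :: ('a \<Rightarrow> real) set) (\<theta>CV :: ('a \<Rightarrow> real) \<Rightarrow> 'a list \<Rightarrow> 't).
        (\<forall>f0\<in>B. \<forall>n\<ge>1. is_arg_min (\<lambda>\<theta>. cv_loss (K \<theta>) f0 (first_pts x n)) (\<lambda>\<theta>. \<theta> \<in> \<Theta>)
                                  (\<theta>CV f0 (first_pts x n))) \<longrightarrow>
        limsup (\<lambda>n. SUP \<theta>\<in>\<Delta>. SUP f0\<in>B. ereal (
            \<Sum>i=1..n.
              (f0 (x i) - cond_mean (K \<theta>0) f0 (removeAll (x i) (first_pts x n)) (x i))\<^sup>2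
                / cond_var (K \<theta>0) (removeAll (x i) (first_pts x n)) (x i)
              + ln (cond_var (K \<theta>0) (removeAll (x i) (first_pts x n)) (x i)
                    / cond_var (K \<theta>) (removeAll (x i) (first_pts x n)) (x i)))) < 0 \<longrightarrow>
        (\<exists>N. \<forall>f0\<in>B. \<forall>n\<ge>N. \<theta>CV f0 (first_pts x n) \<notin> \<Delta>))"
proof (intro conjI allI impI)
  note x_in = assms(3) and inj = assms(4)
  have pd: "pd_kernel \<Omega> (K \<theta>)" if "\<theta> \<in> \<Theta>" for \<theta>
    using assms(2) that by unfold_locales blast
  have pd_\<Delta>: "pd_kernel \<Omega> (K \<theta>)" if "\<theta> \<in> \<Delta>" for \<theta>
    using pd assms(5) that by blast
  note pd0 = pd[OF assms(6)]
  {
    fix B est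
    assume min: "\<forall>f0\<in>B. \<forall>n\<ge>1. is_arg_min (\<lambda>\<theta>. ml_loss (K \<theta>) f0 (first_pts x n))
        (\<lambda>\<theta>. \<theta> \<in> \<Theta>) (est f0 (first_pts x n))"
      and limsup: "limsup (\<lambda>n. SUP \<theta>\<in>\<Delta>. SUP f0\<in>B. ereal (
            (rkhs_norm \<Omega> (K \<theta>0) (cond_mean (K \<theta>0) f0 (first_pts x n)))\<^sup>2
            + (\<Sum>i=1..n. ln (cond_var (K \<theta>0) (first_pts x (i - 1)) (x i)
                             / cond_var (K \<theta>) (first_pts x (i - 1)) (x i))))) < 0"
    show "\<exists>N. \<forall>f0\<in>B. \<forall>n\<ge>N. est f0 (first_pts x n) \<notin> \<Delta>"
    proof (rule eventually_minimizer_notin[OF limsup _ _ assms(6)])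
      fix n \<theta> f0 assume "\<theta> \<in> \<Delta>"
      note pd\<theta> = pd_\<Delta>[OF this]
      \<comment> \<open>The data-fit term of \<open>\<theta>\<close>, the only one missing from the
        bound.\<close>
      have "0 \<le> pd_kernel.gram_form (K \<theta>) (set (first_pts x n)) f0 f0"
        using pd_kernel.gram_form_nonneg[OF pd\<theta>] pd_kernel.first_pts_subset[OF pd\<theta> x_in inj] by simp
      moreover have "(\<Sum>i=1..n. ln (cond_var (K \<theta>0) (first_pts x (i - 1)) (x i)
                             / cond_var (K \<theta>) (first_pts x (i - 1)) (x i)))
        = (\<Sum>i=1..n. ln (cond_var (K \<theta>0) (first_pts x (i - 1)) (x i)))
          - (\<Sum>i=1..n. ln (cond_var (K \<theta>) (first_pts x (i - 1)) (x i)))"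
        unfolding sum_subtractf[symmetric]
      proof (rule sum.cong[OF refl], rule ln_divide_pos)
        fix i assume "i \<in> {1..n}"
        then show "0 < cond_var (K \<theta>0) (first_pts x (i - 1)) (x i)"
          "0 < cond_var (K \<theta>) (first_pts x (i - 1)) (x i)"
          using pd_kernel.cond_var_first_pts_pos[OF pd0 x_in inj]
            pd_kernel.cond_var_first_pts_pos[OF pd\<theta> x_in inj] by auto
      qed
      ultimately show "ml_loss (K \<theta>0) f0 (first_pts x n) - ml_loss (K \<theta>) f0 (first_pts x n)
        \<le> (rkhs_norm \<Omega> (K \<theta>0) (cond_mean (K \<theta>0) f0 (first_pts x n)))\<^sup>2
            + (\<Sum>i=1..n. ln (cond_var (K \<theta>0) (first_pts x (i - 1)) (x i)
                             / cond_var (K \<theta>) (first_pts x (i - 1)) (x i)))"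
        unfolding pd_kernel.ml_loss_first_pts[OF pd0 x_in inj]
          pd_kernel.ml_loss_first_pts[OF pd\<theta> x_in inj]
          pd_kernel.rkhs_norm_cond_mean[OF pd0 distinct_first_pts[OF inj]
            pd_kernel.first_pts_subset[OF pd0 x_in inj]]
        by linarith
    qed (use min in blast)
  next
    fix B est
    assume min: "\<forall>f0\<in>B. \<forall>n\<ge>1. is_arg_min (\<lambda>\<theta>. cv_loss (K \<theta>) f0 (first_pts x n))
        (\<lambda>\<theta>. \<theta> \<in> \<Theta>) (est f0 (first_pts x n))"
      and limsup: "limsup (\<lambda>n. SUP \<theta>\<in>\<Delta>. SUP f0\<in>B. ereal (
            \<Sum>i=1..n.
              (f0 (x i) - cond_mean (K \<theta>0) f0 (removeAll (x i) (first_pts x n)) (x i))\<^sup>2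
                / cond_var (K \<theta>0) (removeAll (x i) (first_pts x n)) (x i)
              + ln (cond_var (K \<theta>0) (removeAll (x i) (first_pts x n)) (x i)
                    / cond_var (K \<theta>) (removeAll (x i) (first_pts x n)) (x i)))) < 0"
    show "\<exists>N. \<forall>f0\<in>B. \<forall>n\<ge>N. est f0 (first_pts x n) \<notin> \<Delta>"
    proof (rule eventually_minimizer_notin[OF limsup _ _ assms(6)])
      fix n \<theta> f0 assume "\<theta> \<in> \<Delta>"
      note pd\<theta> = pd_\<Delta>[OF this]
      show "cv_loss (K \<theta>0) f0 (first_pts x n) - cv_loss (K \<theta>) f0 (first_pts x n)
        \<le> (\<Sum>i=1..n.
              (f0 (x i) - cond_mean (K \<theta>0) f0 (removeAll (x i) (first_pts x n)) (x i))\<^sup>2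
                / cond_var (K \<theta>0) (removeAll (x i) (first_pts x n)) (x i)
              + ln (cond_var (K \<theta>0) (removeAll (x i) (first_pts x n)) (x i)
                    / cond_var (K \<theta>) (removeAll (x i) (first_pts x n)) (x i)))"
        unfolding pd_kernel.cv_loss_first_pts[OF pd0 x_in inj]
          pd_kernel.cv_loss_first_pts[OF pd\<theta> x_in inj] sum_subtractf[symmetric]
      proof (rule sum_mono)
        fix i assume "i \<in> {1..n}"
        then have i: "1 \<le> i" by simp
        let ?V = "\<lambda>\<theta>. cond_var (K \<theta>) (removeAll (x i) (first_pts x n)) (x i)"
        let ?r = "\<lambda>\<theta>. (f0 (x i) - cond_mean (K \<theta>) f0 (removeAll (x i) (first_pts x n)) (x i))\<^sup>2"
        have V: "0 < ?V \<theta>0" "0 < ?V \<theta>"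
          using pd_kernel.cond_var_removeAll_pos[OF _ x_in inj i] pd0 pd\<theta> by blast+
        \<comment> \<open>For cross-validation the data-fit term of \<open>\<theta>\<close> is
          dropped summand by summand.\<close>
        then have "0 \<le> ?r \<theta> / ?V \<theta>" by simp
        with V show "?r \<theta>0 / ?V \<theta>0 + ln (?V \<theta>0) - (?r \<theta> / ?V \<theta> + ln (?V \<theta>))
          \<le> ?r \<theta>0 / ?V \<theta>0 + ln (?V \<theta>0 / ?V \<theta>)"
          by (simp add: ln_div)
      qed
    qed (use min in blast)
  }
qed

end
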